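(* Let $H,\kappa\in\mathbb{R}$ with $\kappa+4H^2<0$, and consider the model of $E(\kappa+4H^2,H)$ given by $\{(x,y,z)\in\mathbb{R}^3: y>0\}$ with the metric \[\mathrm{d}s^2=\lambda^2(\mathrm{d}x^2+\mathrm{d}y^2)+(2Hy\lambda^2\,\mathrm{d}x+\mathrm{d}z)^2,\qquad \lambda=\frac{1}{\sqrt{-\kappa-4H^2}\;y}.\] Use polar coordinates $x=r\cos s$, $y=r\sin s$ with $r>0$, $0<s<\pi/2$. Then for either choice of the sign $\pm$ the graph $z=u(s)$ (independent of $r$) of \[u(s)=\frac{1}{4H^2+\kappa}\left(-2Hs\pm\int_0^s\sqrt{\frac{4H^2\cos^2t-(4H^2+\kappa)}{1-\sin^2t}}\,\mathrm{d}t\right)\] is a minimal surface. Moreover, for a suitable choice of the sign, $u$ has zero boundary value at $s=0$ (the positive $x$-axis) and $u(s)\to+\infty$ as $s\to\pi/2$ (i.e. along the geodesic $\{x=0,\ y>0\}$ of the base).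
   Context: $E(c,\tau)$ denotes the simply connected homogeneous 3-manifold fibering over the simply connected surface $\Sigma(c)$ of constant curvature $c$ by a Riemannian submersion with geodesic fibers and constant bundle curvature $\tau$. In the given model with $c=\kappa+4H^2$, $\tau=H$, the fibration is $(x,y,z)\mapsto(x,y)$ onto the upper half-plane model of $\Sigma(\kappa+4H^2)$ with metric $\lambda^2(\mathrm{d}x^2+\mathrm{d}y^2)$, and the vertical unit field is $\partial_z$. *)

theory Defs
  imports "HOL-Analysis.Analysis"
begin

section \<open>Riemannian metrics on open subsets of Euclidean space, in coordinates\<close>

text \<open>A metric assigns to a point a bilinear form on tangent vectors; all indices refer to the
  standard coordinates.\<close>

type_synonym 'n metric = "real^'n \<Rightarrow> real^'n \<Rightarrow> real^'n \<Rightarrow> real"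

definition partial_deriv :: "'n::finite \<Rightarrow> (real^'n \<Rightarrow> 'b::real_normed_vector) \<Rightarrow> real^'n \<Rightarrow> 'b" where
  "partial_deriv i F p = frechet_derivative F (at p) (axis i 1)"

definition metric_matrix :: "('n::finite) metric \<Rightarrow> real^'n \<Rightarrow> real^'n^'n" where
  "metric_matrix g p = (\<chi> i j. g p (axis i 1) (axis j 1))"

definition christoffel :: "('n::finite) metric \<Rightarrow> real^'n \<Rightarrow> 'n \<Rightarrow> 'n \<Rightarrow> 'n \<Rightarrow> real" where
  "christoffel g p k i j = 1 / 2 * (\<Sum>l\<in>UNIV. matrix_inv (metric_matrix g p) $ k $ l *
     (partial_deriv i (\<lambda>q. metric_matrix g q $ j $ l) p
    + partial_deriv j (\<lambda>q. metric_matrix g q $ i $ l) p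
    - partial_deriv l (\<lambda>q. metric_matrix g q $ i $ j) p))"

definition geodesic :: "(real^'n) set \<Rightarrow> ('n::finite) metric \<Rightarrow> (real \<Rightarrow> real^'n) \<Rightarrow> bool" where
  "geodesic M g \<gamma> \<longleftrightarrow> (\<exists>\<gamma>' \<gamma>''. \<forall>t. \<gamma> t \<in> M
     \<and> (\<gamma> has_vector_derivative \<gamma>' t) (at t) \<and> (\<gamma>' has_vector_derivative \<gamma>'' t) (at t)
     \<and> (\<forall>k. \<gamma>'' t $ k
            + (\<Sum>i\<in>UNIV. \<Sum>j\<in>UNIV. christoffel g (\<gamma> t) k i j * \<gamma>' t $ i * \<gamma>' t $ j) = 0))"

section \<open>Mean curvature and minimal surfaces\<close>

definition C2_on :: "(real^'d::finite) set \<Rightarrow> (real^'d \<Rightarrow> 'b::real_normed_vector) \<Rightarrow> bool" where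
  "C2_on U X \<longleftrightarrow> (\<forall>q\<in>U. X differentiable (at q))
     \<and> (\<forall>i. \<forall>q\<in>U. partial_deriv i X differentiable (at q))
     \<and> (\<forall>i j. continuous_on U (partial_deriv i (partial_deriv j X)))"

text \<open>The covariant derivative (Levi-Civita connection of \<open>g\<close>) of the coordinate field
  \<open>\<partial>\<^sub>j X\<close> in direction \<open>\<partial>\<^sub>i X\<close> along the parametrization \<open>X\<close>.\<close>

definition cov_deriv ::
    "3 metric \<Rightarrow> (real^2 \<Rightarrow> real^3) \<Rightarrow> real^2 \<Rightarrow> 2 \<Rightarrow> 2 \<Rightarrow> real^3" where
  "cov_deriv g X q i j = (\<chi> k. partial_deriv i (partial_deriv j X) q $ k
     + (\<Sum>a\<in>UNIV. \<Sum>b\<in>UNIV. christoffel g (X q) k a b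
           * partial_deriv i X q $ a * partial_deriv j X q $ b))"

definition first_form :: "3 metric \<Rightarrow> (real^2 \<Rightarrow> real^3) \<Rightarrow> real^2 \<Rightarrow> real^2^2" where
  "first_form g X q = (\<chi> i j. g (X q) (partial_deriv i X q) (partial_deriv j X q))"

definition unit_normal :: "3 metric \<Rightarrow> (real^2 \<Rightarrow> real^3) \<Rightarrow> real^2 \<Rightarrow> real^3 \<Rightarrow> bool" where
  "unit_normal g X q N \<longleftrightarrow> g (X q) N N = 1 \<and> (\<forall>i. g (X q) N (partial_deriv i X q) = 0)"

definition second_form ::
    "3 metric \<Rightarrow> (real^2 \<Rightarrow> real^3) \<Rightarrow> real^3 \<Rightarrow> real^2 \<Rightarrow> real^2^2" where
  "second_form g X N q = (\<chi> i j. g (X q) (cov_deriv g X q i j) N)"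

definition mean_curvature ::
    "3 metric \<Rightarrow> (real^2 \<Rightarrow> real^3) \<Rightarrow> real^3 \<Rightarrow> real^2 \<Rightarrow> real" where
  "mean_curvature g X N q =
     1 / 2 * trace (matrix_inv (first_form g X q) ** second_form g X N q)"

definition local_parametrization ::
    "(real^3) set \<Rightarrow> real^3 \<Rightarrow> (real^2) set \<Rightarrow> (real^2 \<Rightarrow> real^3) \<Rightarrow> bool" where
  "local_parametrization S p U X \<longleftrightarrow>
     open U \<and> C2_on U X \<and> (\<forall>q\<in>U. inj (frechet_derivative X (at q)))
     \<and> (\<exists>V Y. open V \<and> p \<in> V \<and> homeomorphism U (S \<inter> V) X Y)"

text \<open>Vanishing of the mean curvature depends neither on the parametrization nor on which of the
  two unit normals is used.\<close>

definition minimal_surface :: "(real^3) set \<Rightarrow> 3 metric \<Rightarrow> (real^3) set \<Rightarrow> bool" where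
  "minimal_surface M g S \<longleftrightarrow> S \<subseteq> M \<and> (\<forall>p\<in>S. \<exists>U X. local_parametrization S p U X
     \<and> (\<forall>q\<in>U. \<forall>N. unit_normal g X q N \<longrightarrow> mean_curvature g X N q = 0))"

section \<open>The half-space model of \<open>E(\<kappa> + 4 H\<^sup>2, H)\<close>\<close>

definition conf_factor :: "real \<Rightarrow> real \<Rightarrow> real \<Rightarrow> real" where
  "conf_factor H \<kappa> y = 1 / (sqrt (- \<kappa> - 4 * H\<^sup>2) * y)"

definition base_space :: "(real^2) set" where
  "base_space = {p. p $ 2 > 0}"

definition base_metric :: "real \<Rightarrow> real \<Rightarrow> 2 metric" where
  "base_metric H \<kappa> p v w = (conf_factor H \<kappa> (p $ 2))\<^sup>2 * (v $ 1 * w $ 1 + v $ 2 * w $ 2)"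

definition E_space :: "(real^3) set" where
  "E_space = {p. p $ 2 > 0}"

text \<open>The polarization of
  \<open>ds\<^sup>2 = \<lambda>\<^sup>2 (dx\<^sup>2 + dy\<^sup>2) + (2 H y \<lambda>\<^sup>2 dx + dz)\<^sup>2\<close>.\<close>

definition E_metric :: "real \<Rightarrow> real \<Rightarrow> 3 metric" where
  "E_metric H \<kappa> p v w =
     (let y = p $ 2; l = conf_factor H \<kappa> y in
        l\<^sup>2 * (v $ 1 * w $ 1 + v $ 2 * w $ 2)
      + (2 * H * y * l\<^sup>2 * v $ 1 + v $ 3) * (2 * H * y * l\<^sup>2 * w $ 1 + w $ 3))"

section \<open>The graphs\<close>

text \<open>The sign is the parameter \<open>\<sigma>\<close>, either \<open>1\<close> or \<open>-1\<close>.\<close>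

definition profile :: "real \<Rightarrow> real \<Rightarrow> real \<Rightarrow> real \<Rightarrow> real" where
  "profile H \<kappa> \<sigma> s = 1 / (4 * H\<^sup>2 + \<kappa>) * (- 2 * H * s + \<sigma> *
     integral {0..s} (\<lambda>t. sqrt ((4 * H\<^sup>2 * (cos t)\<^sup>2 - (4 * H\<^sup>2 + \<kappa>)) / (1 - (sin t)\<^sup>2))))"

definition polar_graph :: "(real \<Rightarrow> real) \<Rightarrow> (real^3) set" where
  "polar_graph u = {vector [r * cos s, r * sin s, u s] | r s. r > 0 \<and> 0 < s \<and> s < pi / 2}"

definition quadrant :: "(real^2) set" where
  "quadrant = {p. p $ 1 > 0 \<and> p $ 2 > 0}"

text \<open>The function on the quadrant whose graph is \<open>polar_graph u\<close>; there the polar angle of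
  \<open>(x, y)\<close> is \<open>arctan (y / x)\<close>.\<close>

definition graph_fun :: "(real \<Rightarrow> real) \<Rightarrow> real^2 \<Rightarrow> real" where
  "graph_fun u p = u (arctan (p $ 2 / p $ 1))"

end

theory Submission
  imports Defs
begin

text \<open>
  Put \<open>m = - (\<kappa> + 4 H\<^sup>2) > 0\<close> and \<open>h = 2 H / m\<close>. A graph \<open>z = u\<close> is minimal iff
  \<open>\<partial>\<^sub>x ((u\<^sub>x + h / y) / W) + \<partial>\<^sub>y (u\<^sub>y / W) = 0\<close> for the area density \<open>W\<close>. If \<open>u\<close> depends on the polar angle
  only, this says that \<open>w / W\<close> is constant, where \<open>w = u' - h\<close> and
  \<open>W\<^sup>2 = 1 + m h\<^sup>2 cos\<^sup>2 s + m w\<^sup>2 sin\<^sup>2 s\<close>. The constant \<open>\<plusminus> 1 / sqrt m\<close> gives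
  \<open>m w\<^sup>2 cos\<^sup>2 s = 1 + m h\<^sup>2 cos\<^sup>2 s\<close>, which is the given profile. With this equation and its derivative the
  mean curvature, computed from the Christoffel symbols in the parametrization by \<open>(r, s)\<close>, vanishes
  identically. Near \<open>s = \<pi> / 2\<close> the integrand is at least \<open>sqrt m / cos s\<close>, so the negative sign of
  \<open>\<sigma>\<close> gives the boundary value \<open>+\<infinity>\<close>.
\<close>

section \<open>Coordinate derivatives and matrix inverses\<close>

lemma partial_deriv_eqI:
  "(F has_derivative F') (at p) \<Longrightarrow> partial_deriv i F p = F' (axis i 1)"
  unfolding partial_deriv_def using frechet_derivative_at by metis

lemma has_derivative_comp_nth:
  assumes "(\<phi> has_real_derivative d) (at (p $ l))"
  shows "((\<lambda>q::real^'n::finite. \<phi> (q $ l)) has_derivative (\<lambda>v. d * v $ l)) (at p)"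
  using has_derivative_compose[OF bounded_linear.has_derivative[OF bounded_linear_vec_nth has_derivative_ident]]
    assms by (metis has_field_derivative_def)

text \<open>Both metrics have coefficients depending on \<open>y\<close> alone, so this reduces
  every partial derivative in the Christoffel symbols to an ordinary one.\<close>

lemma partial_deriv_comp_nth:
  fixes \<phi> :: "real \<Rightarrow> real" and p :: "real^'n::finite"
  assumes "(\<phi> has_real_derivative d) (at (p $ l))"
  shows "partial_deriv i (\<lambda>q. \<phi> (q $ l)) p = (if i = l then d else 0)"
  using partial_deriv_eqI[OF has_derivative_comp_nth[OF assms]] by (simp add: axis_def)

text \<open>\<open>matrix_inv\<close> is a choice among two-sided inverses. A right inverse of a
  square matrix is two-sided, and such an inverse is unique, so the choice is determined.\<close>

lemma matrix_inv_eqI: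
  fixes A B :: "real^'n^'n"
  assumes "A ** B = mat 1"
  shows "matrix_inv A = B"
proof -
  have "B ** A = mat 1" using assms matrix_left_right_inverse by blast
  then have *: "A ** matrix_inv A = mat 1 \<and> matrix_inv A ** A = mat 1"
    unfolding matrix_inv_def using assms by - (rule someI_ex, blast)
  have "matrix_inv A = matrix_inv A ** (A ** B)" by (simp add: assms)
  also have "\<dots> = B" by (simp add: * matrix_mul_assoc)
  finally show ?thesis .
qed

section \<open>The metric and its Christoffel symbols\<close>

text \<open>For \<open>y > 0\<close> the squared conformal factor is \<open>1 / (m * y^2)\<close>,
  and the coefficient of \<open>dx\<close> in the vertical form becomes \<open>h / y\<close>. Since
  division by 0 yields 0, the identity persists at \<open>y = 0\<close>; without a side condition it
  can be used under a derivative.\<close>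

lemma E_metric_eq:
  fixes H \<kappa> m h :: real
  assumes m: "m = - \<kappa> - 4 * H\<^sup>2" "m > 0" and h: "h = 2 * H / m"
  shows "E_metric H \<kappa> p v w = (v $ 1 * w $ 1 + v $ 2 * w $ 2) / (m * (p $ 2)\<^sup>2)
    + (h / p $ 2 * v $ 1 + v $ 3) * (h / p $ 2 * w $ 1 + w $ 3)"
proof -
  have "(conf_factor H \<kappa> y)\<^sup>2 = 1 / (m * y\<^sup>2)" for y
    using m by (simp add: conf_factor_def power_mult_distrib power_divide)
  then show ?thesis
    by (cases "p $ 2 = 0") (simp_all add: E_metric_def Let_def h power2_eq_square)
qed

definition E_matrix :: "real \<Rightarrow> real \<Rightarrow> real \<Rightarrow> real^3^3" where
  "E_matrix m h y = vector [vector [(1 / m + h\<^sup>2) / y\<^sup>2, 0, h / y],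
     vector [0, 1 / (m * y\<^sup>2), 0], vector [h / y, 0, 1]]"

definition E_matrix_deriv :: "real \<Rightarrow> real \<Rightarrow> real \<Rightarrow> real^3^3" where
  "E_matrix_deriv m h y = vector [vector [- 2 * (1 / m + h\<^sup>2) / y ^ 3, 0, - h / y\<^sup>2],
     vector [0, - 2 / (m * y ^ 3), 0], vector [- h / y\<^sup>2, 0, 0]]"

lemma E_matrix_has_derivative:
  assumes "y > 0" "m > 0"
  shows "((\<lambda>y. E_matrix m h y $ i $ j) has_real_derivative E_matrix_deriv m h y $ i $ j) (at y)"
proof -
  have "\<forall>i j. ((\<lambda>y. E_matrix m h y $ i $ j) has_real_derivative E_matrix_deriv m h y $ i $ j) (at y)"
    unfolding forall_3 E_matrix_def E_matrix_deriv_def vector_3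
    using assms
    by (intro conjI; (auto intro!: derivative_eq_intros simp: field_simps power2_eq_square power3_eq_cube)?)
  then show ?thesis by blast
qed

lemma matrix_inv_E_matrix:
  assumes "y > 0" "m > 0"
  shows "matrix_inv (E_matrix m h y) = vector [vector [m * y\<^sup>2, 0, - m * h * y],
     vector [0, m * y\<^sup>2, 0], vector [- m * h * y, 0, 1 + m * h\<^sup>2]]"
  using assms
  by (intro matrix_inv_eqI)
    (simp add: vec_eq_iff forall_3 matrix_matrix_mult_def sum_3 mat_def E_matrix_def field_simps power2_eq_square)

lemma metric_matrix_E:
  assumes "m = - \<kappa> - 4 * H\<^sup>2" "m > 0" "h = 2 * H / m"
  shows "metric_matrix (E_metric H \<kappa>) p = E_matrix m h (p $ 2)"
  by (simp add: vec_eq_iff forall_3 metric_matrix_def E_metric_eq[OF assms] E_matrix_def axis_def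
      add_divide_distrib power2_eq_square)

text \<open>The coefficients vary with \<open>y\<close> only, so just the derivatives in direction 2
  survive.\<close>

lemma christoffel_E:
  fixes p :: "real^3"
  assumes m: "m = - \<kappa> - 4 * H\<^sup>2" "m > 0" "h = 2 * H / m" and "p $ 2 > 0"
  shows "christoffel (E_metric H \<kappa>) p k i j =
    1 / 2 * (\<Sum>l\<in>UNIV. matrix_inv (E_matrix m h (p $ 2)) $ k $ l *
     ((if i = 2 then E_matrix_deriv m h (p $ 2) $ j $ l else 0)
    + (if j = 2 then E_matrix_deriv m h (p $ 2) $ i $ l else 0)
    - (if l = 2 then E_matrix_deriv m h (p $ 2) $ i $ j else 0)))"
  unfolding christoffel_def metric_matrix_E[OF m]
  by (simp add: partial_deriv_comp_nth[OF E_matrix_has_derivative[OF \<open>p $ 2 > 0\<close> \<open>m > 0\<close>]])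

text \<open>Covariant derivatives involve the symbols only contracted with two tangent vectors, so
  three bilinear forms replace the table of 27 symbols.\<close>

lemma christoffel_E_contract:
  fixes p v w :: "real^3"
  assumes m: "m = - \<kappa> - 4 * H\<^sup>2" "m > 0" "h = 2 * H / m" and p: "p $ 2 > 0"
  defines "\<Gamma> \<equiv> \<lambda>k. \<Sum>a\<in>UNIV. \<Sum>b\<in>UNIV. christoffel (E_metric H \<kappa>) p k a b * v $ a * w $ b"
  shows "\<Gamma> 1 = - (1 + m * h\<^sup>2 / 2) / p $ 2 * (v $ 1 * w $ 2 + v $ 2 * w $ 1)
      - m * h / 2 * (v $ 2 * w $ 3 + v $ 3 * w $ 2)"
    and "\<Gamma> 2 = ((1 + m * h\<^sup>2) * v $ 1 * w $ 1 - v $ 2 * w $ 2) / p $ 2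
      + m * h / 2 * (v $ 1 * w $ 3 + v $ 3 * w $ 1)"
    and "\<Gamma> 3 = h * (1 + m * h\<^sup>2) / (2 * (p $ 2)\<^sup>2) * (v $ 1 * w $ 2 + v $ 2 * w $ 1)
      + m * h\<^sup>2 / (2 * p $ 2) * (v $ 2 * w $ 3 + v $ 3 * w $ 2)"
  using p \<open>m > 0\<close>
  by (simp_all add: \<Gamma>_def christoffel_E[OF m p] sum_3 matrix_inv_E_matrix E_matrix_deriv_def
      field_simps power2_eq_square power3_eq_cube)

section \<open>The trace criterion and calculus of vector-valued maps\<close>

text \<open>By the adjugate formula the trace is this numerator divided by the determinant;
  minimality thus becomes a polynomial condition on the two fundamental forms.\<close>

lemma trace_matrix_inv_2:
  fixes A S :: "real^2^2"
  assumes "A $ 1 $ 1 * A $ 2 $ 2 - A $ 1 $ 2 * A $ 2 $ 1 \<noteq> 0"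
    and "A $ 1 $ 1 * S $ 2 $ 2 - A $ 1 $ 2 * S $ 2 $ 1 - A $ 2 $ 1 * S $ 1 $ 2 + A $ 2 $ 2 * S $ 1 $ 1 = 0"
  shows "trace (matrix_inv A ** S) = 0"
proof -
  define D where "D = A $ 1 $ 1 * A $ 2 $ 2 - A $ 1 $ 2 * A $ 2 $ 1"
  have "D \<noteq> 0" using assms(1) by (simp add: D_def)
  have "matrix_inv A = vector [vector [A $ 2 $ 2 / D, - A $ 1 $ 2 / D], vector [- A $ 2 $ 1 / D, A $ 1 $ 1 / D]]"
    using \<open>D \<noteq> 0\<close>
    by (intro matrix_inv_eqI)
      (simp add: vec_eq_iff forall_2 matrix_matrix_mult_def sum_2 mat_def,
        simp add: field_simps, simp add: D_def algebra_simps)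
  then have "trace (matrix_inv A ** S) =
    (A $ 1 $ 1 * S $ 2 $ 2 - A $ 1 $ 2 * S $ 2 $ 1 - A $ 2 $ 1 * S $ 1 $ 2 + A $ 2 $ 2 * S $ 1 $ 1) / D"
    using \<open>D \<noteq> 0\<close> by (simp add: trace_def matrix_matrix_mult_def sum_2 field_simps)
  then show ?thesis by (simp add: assms(2))
qed

text \<open>As a linear combination of constant vectors, a list-style vector becomes accessible to
  the standard rules for derivatives and continuity.\<close>

lemma vector_3_eq_axes:
  "(vector [a, b, c] :: real^3) = a *\<^sub>R axis 1 1 + b *\<^sub>R axis 2 1 + c *\<^sub>R axis 3 1"
  by (simp add: vec_eq_iff forall_3 axis_def)

lemma has_derivative_vector_3:
  fixes f g h :: "'a::real_normed_vector \<Rightarrow> real"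
  assumes "(f has_derivative f') F" "(g has_derivative g') F" "(h has_derivative h') F"
  shows "((\<lambda>x. vector [f x, g x, h x] :: real^3) has_derivative (\<lambda>x. vector [f' x, g' x, h' x])) F"
  unfolding vector_3_eq_axes by (intro derivative_intros assms)

lemma continuous_on_vector_3:
  fixes f g h :: "'a::topological_space \<Rightarrow> real"
  assumes "continuous_on S f" "continuous_on S g" "continuous_on S h"
  shows "continuous_on S (\<lambda>x. vector [f x, g x, h x] :: real^3)"
  unfolding vector_3_eq_axes by (intro continuous_intros assms)

lemma continuous_on_vector_2:
  fixes f g :: "'a::topological_space \<Rightarrow> real"
  assumes "continuous_on S f" "continuous_on S g"
  shows "continuous_on S (\<lambda>x. vector [f x, g x] :: real^2)"
proof -
  have *: "(vector [a, b] :: real^2) = a *\<^sub>R axis 1 1 + b *\<^sub>R axis 2 1" for a b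
    by (simp add: vec_eq_iff forall_2 axis_def)
  show ?thesis unfolding * by (intro continuous_intros assms)
qed

section \<open>The polar parametrization of an angular graph\<close>

definition polar_domain :: "(real^2) set" where
  "polar_domain = {q. q $ 1 > 0 \<and> 0 < q $ 2 \<and> q $ 2 < pi / 2}"

definition polar_param :: "(real \<Rightarrow> real) \<Rightarrow> real^2 \<Rightarrow> real^3" where
  "polar_param u q = vector [q $ 1 * cos (q $ 2), q $ 1 * sin (q $ 2), u (q $ 2)]"

lemma open_polar_domain: "open polar_domain"
  unfolding polar_domain_def
  by (intro open_Collect_conj open_Collect_less continuous_intros)

text \<open>The geometry of an angular graph is developed for an abstract profile given with its
  first two derivatives; the integral formula enters only later.\<close>

locale C2_profile =
  fixes u u' u'' :: "real \<Rightarrow> real"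
  assumes u: "0 < s \<Longrightarrow> s < pi / 2 \<Longrightarrow> (u has_real_derivative u' s) (at s)"
    and u': "0 < s \<Longrightarrow> s < pi / 2 \<Longrightarrow> (u' has_real_derivative u'' s) (at s)"
    and u'': "continuous_on {0<..<pi / 2} u''"
begin

abbreviation "X \<equiv> polar_param u"

lemmas vec_nth_has_derivative =
  bounded_linear.has_derivative[OF bounded_linear_vec_nth has_derivative_ident]
lemmas cos_nth_has_derivative = has_derivative_comp_nth[OF DERIV_cos]
lemmas sin_nth_has_derivative = has_derivative_comp_nth[OF DERIV_sin]

lemma X_has_derivative:
  assumes "q \<in> polar_domain"
  shows "(X has_derivative (\<lambda>v. vector
     [v $ 1 * cos (q $ 2) - v $ 2 * (q $ 1 * sin (q $ 2)),
      v $ 1 * sin (q $ 2) + v $ 2 * (q $ 1 * cos (q $ 2)), u' (q $ 2) * v $ 2])) (at q)"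
  unfolding polar_param_def
  using has_derivative_comp_nth[OF u, of q 2] assms
  by (intro has_derivative_eq_rhs[OF has_derivative_vector_3[OF
      has_derivative_mult[OF vec_nth_has_derivative cos_nth_has_derivative]
      has_derivative_mult[OF vec_nth_has_derivative sin_nth_has_derivative]]])
    (auto simp: polar_domain_def algebra_simps)

lemma partial_deriv_X:
  assumes "q \<in> polar_domain"
  shows "partial_deriv 1 X q = vector [cos (q $ 2), sin (q $ 2), 0]"
    and "partial_deriv 2 X q = vector [- q $ 1 * sin (q $ 2), q $ 1 * cos (q $ 2), u' (q $ 2)]"
  by (simp_all add: partial_deriv_eqI[OF X_has_derivative[OF assms]] axis_def)

lemma partial_deriv_X_has_derivative:
  assumes "q \<in> polar_domain"
  shows "(partial_deriv 1 X has_derivative (\<lambda>v. vector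
     [- v $ 2 * sin (q $ 2), v $ 2 * cos (q $ 2), 0])) (at q)" (is ?A)
    and "(partial_deriv 2 X has_derivative (\<lambda>v. vector
     [- v $ 1 * sin (q $ 2) - v $ 2 * (q $ 1 * cos (q $ 2)),
      v $ 1 * cos (q $ 2) - v $ 2 * (q $ 1 * sin (q $ 2)), u'' (q $ 2) * v $ 2])) (at q)" (is ?B)
proof -
  have "((\<lambda>q::real^2. vector [cos (q $ 2), sin (q $ 2), 0] :: real^3) has_derivative (\<lambda>v. vector
     [- v $ 2 * sin (q $ 2), v $ 2 * cos (q $ 2), 0])) (at q)"
    by (rule has_derivative_eq_rhs[OF has_derivative_vector_3[OF
        cos_nth_has_derivative sin_nth_has_derivative has_derivative_const]])
      (simp add: mult.commute)
  \<comment> \<open>The formula for the partial derivative is known only on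
    \<open>polar_domain\<close>; openness lets it be differentiated there.\<close>
  then show ?A
    by (rule has_derivative_transform_within_open[OF _ open_polar_domain assms])
      (simp add: partial_deriv_X)
  have "((\<lambda>q::real^2. vector [- q $ 1 * sin (q $ 2), q $ 1 * cos (q $ 2), u' (q $ 2)] :: real^3)
    has_derivative (\<lambda>v. vector
     [- v $ 1 * sin (q $ 2) - v $ 2 * (q $ 1 * cos (q $ 2)),
      v $ 1 * cos (q $ 2) - v $ 2 * (q $ 1 * sin (q $ 2)), u'' (q $ 2) * v $ 2])) (at q)"
    using has_derivative_comp_nth[OF u', of q 2] assms
    by (intro has_derivative_eq_rhs[OF has_derivative_vector_3[OF
        has_derivative_mult[OF has_derivative_minus[OF vec_nth_has_derivative] sin_nth_has_derivative]
        has_derivative_mult[OF vec_nth_has_derivative cos_nth_has_derivative]]])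
      (auto simp: polar_domain_def algebra_simps)
  then show ?B
    by (rule has_derivative_transform_within_open[OF _ open_polar_domain assms])
      (simp add: partial_deriv_X)
qed

lemma partial_deriv2_X:
  assumes "q \<in> polar_domain"
  shows "partial_deriv 1 (partial_deriv 1 X) q = 0"
    and "partial_deriv 2 (partial_deriv 1 X) q = vector [- sin (q $ 2), cos (q $ 2), 0]"
    and "partial_deriv 1 (partial_deriv 2 X) q = vector [- sin (q $ 2), cos (q $ 2), 0]"
    and "partial_deriv 2 (partial_deriv 2 X) q =
      vector [- q $ 1 * cos (q $ 2), - q $ 1 * sin (q $ 2), u'' (q $ 2)]"
  by (simp_all add: partial_deriv_eqI[OF partial_deriv_X_has_derivative(1)[OF assms]]
      partial_deriv_eqI[OF partial_deriv_X_has_derivative(2)[OF assms]] axis_def vec_eq_iff forall_3)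

lemma C2_on_X: "C2_on polar_domain X"
  unfolding C2_on_def
proof (intro conjI ballI allI)
  fix q i j assume q: "q \<in> polar_domain"
  show "X differentiable at q"
    using X_has_derivative[OF q] by (rule differentiableI)
  show "partial_deriv i X differentiable at q"
    using partial_deriv_X_has_derivative[OF q] exhaust_2[of i] by (auto intro: differentiableI)
next
  have "continuous_on polar_domain (\<lambda>q. u'' (q $ 2))"
    by (rule continuous_on_compose2[OF u'']) (auto simp: polar_domain_def intro: continuous_intros)
  then have "continuous_on polar_domain (\<lambda>q. vector
      [- q $ 1 * cos (q $ 2), - q $ 1 * sin (q $ 2), u'' (q $ 2)] :: real^3)"
    and "continuous_on polar_domain (\<lambda>q. vector [- sin (q $ 2), cos (q $ 2), 0] :: real^3)"
    by (auto intro!: continuous_on_vector_3 continuous_intros)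
  then have "\<forall>i j. continuous_on polar_domain (partial_deriv i (partial_deriv j X))"
    unfolding forall_2 using continuous_on_const[of polar_domain "0::real^3"]
    by (simp add: partial_deriv2_X cong: continuous_on_cong)
  then show "continuous_on polar_domain (partial_deriv i (partial_deriv j X))" for i j by blast
qed

lemma inj_frechet_derivative_X:
  assumes q: "q \<in> polar_domain"
  shows "inj (frechet_derivative X (at q))"
proof -
  let ?D = "\<lambda>v::real^2. vector
     [v $ 1 * cos (q $ 2) - v $ 2 * (q $ 1 * sin (q $ 2)),
      v $ 1 * sin (q $ 2) + v $ 2 * (q $ 1 * cos (q $ 2)), u' (q $ 2) * v $ 2] :: real^3"
  have eq: "frechet_derivative X (at q) = ?D"
    by (rule frechet_derivative_at[OF X_has_derivative[OF q], symmetric])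
  have lin: "linear ?D" by (rule has_derivative_linear[OF X_has_derivative[OF q]])
  show ?thesis unfolding eq linear_injective_0[OF lin]
  proof (intro allI impI)
    fix v :: "real^2" assume v: "?D v = 0"
    define c d r where "c = cos (q $ 2)" and "d = sin (q $ 2)" and "r = q $ 1"
    have "r > 0" using q by (simp add: polar_domain_def r_def)
    have cd: "c\<^sup>2 + d\<^sup>2 = 1" by (simp add: c_def d_def)
    have e: "v $ 1 * c - v $ 2 * (r * d) = 0" "v $ 1 * d + v $ 2 * (r * c) = 0"
      using v by (simp_all add: vec_eq_iff forall_3 c_def d_def r_def)
    \<comment> \<open>The two equations say that a rotation sends \<open>(v $ 1, r * v $ 2)\<close>
      to 0; undoing the rotation uses \<open>cd\<close>.\<close>
    have "v $ 1 = 0" using e cd by algebra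
    moreover have "r * v $ 2 = 0" using e cd by algebra
    ultimately show "v = 0" using \<open>r > 0\<close> by (simp add: vec_eq_iff forall_2)
  qed
qed

lemma homeomorphism_X:
  "homeomorphism polar_domain (polar_graph u) X
     (\<lambda>p. vector [sqrt ((p $ 1)\<^sup>2 + (p $ 2)\<^sup>2), arctan (p $ 2 / p $ 1)])"
  unfolding homeomorphism_def
proof (intro conjI ballI)
  let ?Y = "\<lambda>p::real^3. vector [sqrt ((p $ 1)\<^sup>2 + (p $ 2)\<^sup>2), arctan (p $ 2 / p $ 1)] :: real^2"
  show YX: "?Y (X q) = q" if "q \<in> polar_domain" for q
  proof -
    have "(q $ 1 * cos (q $ 2))\<^sup>2 + (q $ 1 * sin (q $ 2))\<^sup>2 = (q $ 1)\<^sup>2"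
      by (simp add: power_mult_distrib flip: distrib_left)
    moreover have "arctan (tan (q $ 2)) = q $ 2"
      using that by (intro arctan_tan) (auto simp: polar_domain_def)
    ultimately show ?thesis
      using that by (simp add: polar_param_def polar_domain_def vec_eq_iff forall_2 tan_def)
  qed
  show im: "X ` polar_domain = polar_graph u"
  proof (intro equalityI subsetI)
    fix p assume "p \<in> polar_graph u"
    then obtain r s where "p = vector [r * cos s, r * sin s, u s]" "r > 0" "0 < s" "s < pi / 2"
      by (auto simp: polar_graph_def)
    then show "p \<in> X ` polar_domain"
      by (intro image_eqI[of _ _ "vector [r, s]"]) (simp_all add: polar_param_def polar_domain_def)
  qed (auto simp: polar_graph_def polar_param_def polar_domain_def)
  show "?Y ` polar_graph u = polar_domain"
    unfolding im[symmetric] image_image using YX by simp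
  show "X (?Y p) = p" if "p \<in> polar_graph u" for p
    using that YX unfolding im[symmetric] by auto
  show "continuous_on polar_domain X"
    using X_has_derivative has_derivative_continuous continuous_at_imp_continuous_on by blast
  \<comment> \<open>On the graph \<open>p $ 1 = r * cos s\<close> with \<open>cos s > 0\<close>,
    which makes the quotient inside \<open>arctan\<close> continuous.\<close>
  have "p $ 1 \<noteq> 0" if "p \<in> polar_graph u" for p
    using that less_imp_neq[OF cos_gt_zero] by (auto simp: polar_graph_def)
  then show "continuous_on (polar_graph u) ?Y"
    by (intro continuous_on_vector_2 continuous_intros) auto
qed

text \<open>The polar chart covers the whole graph at once, so \<open>V = UNIV\<close> serves for
  every point.\<close>

lemma local_parametrization_X:
  "local_parametrization (polar_graph u) p polar_domain X"
  unfolding local_parametrization_def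
  using open_polar_domain C2_on_X inj_frechet_derivative_X homeomorphism_X
  by (intro conjI exI[of _ UNIV] exI) auto

end

section \<open>The minimal surface equation as an algebraic identity\<close>

text \<open>The assumptions on \<open>w\<close> say that the angular component \<open>w / (r W)\<close> of the divergence-free field
  is constant, and its derivative; \<open>E, F, G\<close> and \<open>L, M, N\<close> are the two fundamental forms (the second
  one up to the factor \<open>n\<close> of lemma \<open>mean_curvature_X\<close>).\<close>

lemma minimal_equation:
  fixes m h w w' r c d n :: real
  assumes pos: "m > 0" "r > 0" "c > 0" "d > 0" and cd: "c\<^sup>2 + d\<^sup>2 = 1"
    and ode: "m * w\<^sup>2 * c\<^sup>2 = 1 + m * h\<^sup>2 * c\<^sup>2" "m * w * w' * c ^ 3 = d"
  defines "E \<equiv> w\<^sup>2 * c\<^sup>2 / (r\<^sup>2 * d\<^sup>2)" and "F \<equiv> h * c * w / (r * d)" and "G \<equiv> 1 / (m * d\<^sup>2) + w\<^sup>2"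
    and "L \<equiv> - (1 + m * h\<^sup>2) * c * w / (r\<^sup>2 * d)"
    and "M \<equiv> (- m * h * w\<^sup>2 / 2 + m * h ^ 3 / 2 + h * (1 + m * h\<^sup>2) * (c\<^sup>2 - d\<^sup>2) / (2 * d\<^sup>2)) / r"
    and "N \<equiv> w' + (1 + m * h\<^sup>2) * w * c / d"
  shows "E * G - F * F \<noteq> 0" and "E * N - 2 * F * M + G * L = 0"
proof -
  have w2: "w\<^sup>2 = (1 / m + h\<^sup>2 * c\<^sup>2) / c\<^sup>2"
    using ode(1) pos by (simp add: field_simps)
  have w0: "w\<^sup>2 > 0" using pos unfolding w2 by (simp add: add_pos_nonneg)
  have ww': "w * w' = d / (m * c ^ 3)"
    using ode(2) pos by (simp add: field_simps)
  \<comment> \<open>By the first equation \<open>w^2 * c^2\<close> exceeds \<open>h^2 * c^2\<close>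
    by exactly \<open>1 / m\<close>, so the determinant is a sum of positive terms times a positive
    factor.\<close>
  have "E * G - F * F = w\<^sup>2 * (c\<^sup>2 / (m * d\<^sup>2) + (w\<^sup>2 * c\<^sup>2 - h\<^sup>2 * c\<^sup>2)) / (r\<^sup>2 * d\<^sup>2)"
    using pos by (simp add: E_def F_def G_def field_simps power2_eq_square)
  also have "w\<^sup>2 * c\<^sup>2 = 1 / m + h\<^sup>2 * c\<^sup>2" using w2 pos by simp
  also have "\<dots> - h\<^sup>2 * c\<^sup>2 = 1 / m" by simp
  finally have "E * G - F * F = w\<^sup>2 * (c\<^sup>2 / (m * d\<^sup>2) + 1 / m) / (r\<^sup>2 * d\<^sup>2)" .
  also have "\<dots> > 0"
    using pos w0 by (intro divide_pos_pos mult_pos_pos add_pos_pos) simp_all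
  finally show "E * G - F * F \<noteq> 0" by simp
  \<comment> \<open>After factoring out \<open>c * w\<close>, the bracket contains \<open>w\<close>
    and \<open>w'\<close> only through \<open>w^2\<close> and \<open>w * w'\<close>; the two
    equations express both rationally in \<open>c\<close> and \<open>d\<close>.\<close>
  have "r\<^sup>2 * d\<^sup>2 * (E * N - 2 * F * M + G * L) =
     c * w * (c * (w * w') + (1 + m * h\<^sup>2) * w\<^sup>2 * c\<^sup>2 / d + h * d * (m * h * w\<^sup>2 - m * h ^ 3)
      - h\<^sup>2 * (1 + m * h\<^sup>2) * (c\<^sup>2 - d\<^sup>2) / d - (1 / (m * d) + w\<^sup>2 * d) * (1 + m * h\<^sup>2))"
    using pos by (simp add: E_def F_def G_def L_def M_def N_def field_simps power2_eq_square power3_eq_cube)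
  also have "c * (w * w') + (1 + m * h\<^sup>2) * w\<^sup>2 * c\<^sup>2 / d + h * d * (m * h * w\<^sup>2 - m * h ^ 3)
      - h\<^sup>2 * (1 + m * h\<^sup>2) * (c\<^sup>2 - d\<^sup>2) / d - (1 / (m * d) + w\<^sup>2 * d) * (1 + m * h\<^sup>2) = 0"
    unfolding ww' w2 using pos
    by (simp add: field_simps power2_eq_square power3_eq_cube)
  finally show "E * N - 2 * F * M + G * L = 0" using pos by simp
qed

section \<open>Mean curvature of an angular graph\<close>

context C2_profile
begin

text \<open>\<open>ode2\<close> is the derivative of \<open>ode1\<close>, simplified by
  \<open>ode1\<close> itself. The proof computes both fundamental forms in polar coordinates and
  reduces to \<open>minimal_equation\<close>.\<close>

lemma mean_curvature_X:
  fixes H \<kappa> m h :: real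
  assumes m: "m = - \<kappa> - 4 * H\<^sup>2" "m > 0" "h = 2 * H / m"
    and ode1: "\<And>s. 0 < s \<Longrightarrow> s < pi / 2 \<Longrightarrow> m * (u' s - h)\<^sup>2 * (cos s)\<^sup>2 = 1 + m * h\<^sup>2 * (cos s)\<^sup>2"
    and ode2: "\<And>s. 0 < s \<Longrightarrow> s < pi / 2 \<Longrightarrow> m * (u' s - h) * u'' s * cos s ^ 3 = sin s"
    and q: "q \<in> polar_domain" and nu: "unit_normal (E_metric H \<kappa>) X q \<nu>"
  shows "mean_curvature (E_metric H \<kappa>) X \<nu> q = 0"
proof -
  define r s where "r = q $ 1" and "s = q $ 2"
  have s: "0 < s" "s < pi / 2" and "r > 0"
    using q by (simp_all add: polar_domain_def r_def s_def)
  define c d where "c = cos s" and "d = sin s"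
  have "c > 0" "d > 0" using s by (simp_all add: c_def d_def cos_gt_zero sin_gt_zero)
  note pos = \<open>m > 0\<close> \<open>r > 0\<close> \<open>c > 0\<close> \<open>d > 0\<close>
  have cd: "c\<^sup>2 + d\<^sup>2 = 1" by (simp add: c_def d_def)
  \<comment> \<open>\<open>w\<close> is the value of the vertical form \<open>h / y dx + dz\<close>
    on the \<open>s\<close>-derivative of the parametrization: there \<open>dx\<close> gives
    \<open>- r * d\<close> and \<open>y = r * d\<close>.\<close>
  define w w' where "w = u' s - h" and "w' = u'' s"
  have ode: "m * w\<^sup>2 * c\<^sup>2 = 1 + m * h\<^sup>2 * c\<^sup>2" "m * w * w' * c ^ 3 = d"
    using ode1[OF s] ode2[OF s] by (simp_all add: w_def w'_def c_def d_def)
  have X: "X q = vector [r * c, r * d, u s]" "X q $ 2 = r * d" "r * d > 0"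
    using pos by (simp_all add: polar_param_def r_def s_def c_def d_def)
  have X1: "partial_deriv 1 X q = vector [c, d, 0]"
    and X2: "partial_deriv 2 X q = vector [- r * d, r * c, w + h]"
    using partial_deriv_X[OF q] by (simp_all add: r_def s_def c_def d_def w_def)
  have X11: "partial_deriv 1 (partial_deriv 1 X) q = 0"
    and X21: "partial_deriv 2 (partial_deriv 1 X) q = vector [- d, c, 0]"
    and X12: "partial_deriv 1 (partial_deriv 2 X) q = vector [- d, c, 0]"
    and X22: "partial_deriv 2 (partial_deriv 2 X) q = vector [- r * c, - r * d, w']"
    using partial_deriv2_X[OF q] by (simp_all add: r_def s_def c_def d_def w'_def)
  note g = E_metric_eq[OF m]
  note \<Gamma> = christoffel_E_contract[OF m, of "X q", unfolded X(2), OF X(3)]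

  \<comment> \<open>\<open>\<alpha>, \<beta>, n\<close> are the components of the covector dual to \<open>\<nu>\<close>; orthogonality to the tangent plane
    expresses all of them through \<open>n\<close>, which then factors out of the second fundamental form.\<close>
  define n where "n = h / (r * d) * \<nu> $ 1 + \<nu> $ 3"
  define \<alpha> \<beta> where "\<alpha> = \<nu> $ 1 / (m * (r * d)\<^sup>2) + h / (r * d) * n"
    and "\<beta> = \<nu> $ 2 / (m * (r * d)\<^sup>2)"
  have lower: "E_metric H \<kappa> (X q) v \<nu> = v $ 1 * \<alpha> + v $ 2 * \<beta> + v $ 3 * n" for v
    by (simp add: g X \<alpha>_def \<beta>_def n_def algebra_simps add_divide_distrib)
  have "E_metric H \<kappa> (X q) v \<nu> = E_metric H \<kappa> (X q) \<nu> v" for v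
    by (simp add: g mult.commute)
  from this[of "partial_deriv i X q" for i] have "\<forall>i. E_metric H \<kappa> (X q) (partial_deriv i X q) \<nu> = 0"
    using nu by (simp add: unit_normal_def)
  then have orth: "c * \<alpha> + d * \<beta> = 0" "- r * d * \<alpha> + r * c * \<beta> + (w + h) * n = 0"
    unfolding forall_2 by (simp_all add: lower X1 X2)
  \<comment> \<open>The two orthogonality relations are a rotation applied to
    \<open>(r * \<alpha>, r * \<beta>)\<close>, inverted by means of \<open>cd\<close>.\<close>
  have "r * \<alpha> = n * (w + h) * d" "r * \<beta> = - n * (w + h) * c"
    using orth cd by algebra+
  then have \<alpha>: "\<alpha> = n * (w + h) * d / r" and \<beta>: "\<beta> = - n * (w + h) * c / r"
    using pos by (simp_all add: field_simps)

  define E F G where "E = w\<^sup>2 * c\<^sup>2 / (r\<^sup>2 * d\<^sup>2)" and "F = h * c * w / (r * d)" and "G = 1 / (m * d\<^sup>2) + w\<^sup>2"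
  define I where "I = first_form (E_metric H \<kappa>) X q"
  have I: "I $ 1 $ 1 = E" "I $ 1 $ 2 = F" "I $ 2 $ 1 = F" "I $ 2 $ 2 = G"
  proof -
    have "I $ 1 $ 1 = (c\<^sup>2 + d\<^sup>2) / (m * (r * d)\<^sup>2) + (h * c / (r * d))\<^sup>2"
      by (simp add: I_def first_form_def X1 X g power2_eq_square)
    also have "\<dots> = (1 + m * h\<^sup>2 * c\<^sup>2) / (m * (r * d)\<^sup>2)"
      using pos by (simp add: cd field_simps)
    \<comment> \<open>The first equation replaces the numerator by \<open>m * w^2 * c^2\<close>,
      which brings the entry into the product form used in \<open>minimal_equation\<close>.\<close>
    also have "\<dots> = E" unfolding ode(1)[symmetric] E_def using pos by (simp add: field_simps)
    finally show "I $ 1 $ 1 = E" .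
    show "I $ 1 $ 2 = F" "I $ 2 $ 1 = F"
      using pos by (simp_all add: I_def first_form_def X1 X2 X g F_def field_simps)
    have "I $ 2 $ 2 = r\<^sup>2 * (c\<^sup>2 + d\<^sup>2) / (m * (r * d)\<^sup>2) + w\<^sup>2"
      using pos by (simp add: I_def first_form_def X2 X g power2_eq_square field_simps)
    then show "I $ 2 $ 2 = G" using pos by (simp add: cd G_def power_mult_distrib)
  qed

  define L M N where "L = - (1 + m * h\<^sup>2) * c * w / (r\<^sup>2 * d)"
    and "M = (- m * h * w\<^sup>2 / 2 + m * h ^ 3 / 2 + h * (1 + m * h\<^sup>2) * (c\<^sup>2 - d\<^sup>2) / (2 * d\<^sup>2)) / r"
    and "N = w' + (1 + m * h\<^sup>2) * w * c / d"
  define S where "S = second_form (E_metric H \<kappa>) X \<nu> q"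
  note S = S_def second_form_def lower cov_deriv_def \<Gamma> X1 X2 X11 X12 X21 X22 \<alpha> \<beta>
  have S11: "S $ 1 $ 1 = n * L"
  proof -
    \<comment> \<open>The entry is first put over a common denominator without any trigonometry; its
      numerator is then reduced modulo \<open>cd\<close> by \<open>algebra\<close>. The other
      entries follow the same pattern, with the numerator called \<open>P\<close>.\<close>
    have "S $ 1 $ 1 = n / (r\<^sup>2 * d) * ((w + h) * (c * d\<^sup>2 - (2 + m * h\<^sup>2) * c * d\<^sup>2
        - (1 + m * h\<^sup>2) * c ^ 3) + h * (1 + m * h\<^sup>2) * c)"
      using pos by (simp add: S, simp add: field_simps power2_eq_square power3_eq_cube)
    also have "(w + h) * (c * d\<^sup>2 - (2 + m * h\<^sup>2) * c * d\<^sup>2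
        - (1 + m * h\<^sup>2) * c ^ 3) + h * (1 + m * h\<^sup>2) * c = - (1 + m * h\<^sup>2) * c * w"
      using cd by algebra
    finally show ?thesis by (simp add: L_def)
  qed
  have S12: "S $ 1 $ 2 = n * M" "S $ 2 $ 1 = n * M"
  proof -
    define P where "P = d\<^sup>2 * (- 2 * (w + h) * (c\<^sup>2 + d\<^sup>2) - (2 + m * h\<^sup>2) * (w + h) * (c\<^sup>2 - d\<^sup>2)
        - m * h * (w + h)\<^sup>2 * (c\<^sup>2 + d\<^sup>2) + 2 * (w + h) * (2 + m * h\<^sup>2) * c\<^sup>2 + m * h\<^sup>2 * (w + h))
        + h * (1 + m * h\<^sup>2) * (c\<^sup>2 - d\<^sup>2)"
    have S: "S $ 1 $ 2 = n / (2 * r * d\<^sup>2) * P" "S $ 2 $ 1 = n / (2 * r * d\<^sup>2) * P"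
      using pos by (simp_all add: S, simp_all add: P_def field_simps power2_eq_square power3_eq_cube)
    have "P = d\<^sup>2 * (- m * h * w\<^sup>2 + m * h ^ 3) + h * (1 + m * h\<^sup>2) * (c\<^sup>2 - d\<^sup>2)"
      unfolding P_def using cd by algebra
    also have "\<dots> = 2 * r * d\<^sup>2 * M"
      using pos by (simp add: M_def field_simps)
    finally have "n / (2 * r * d\<^sup>2) * P = n * M" using pos by simp
    then show "S $ 1 $ 2 = n * M" "S $ 2 $ 1 = n * M" using S by simp_all
  qed
  have S22: "S $ 2 $ 2 = n * N"
  proof -
    define P where "P = w' * d + (w + h) * d\<^sup>2 * ((2 + m * h\<^sup>2) * c - m * h * c * (w + h))
        - (w + h) * c * ((1 + m * h\<^sup>2) * d\<^sup>2 - c\<^sup>2 - m * h * d\<^sup>2 * (w + h))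
        - h * (1 + m * h\<^sup>2) * c + m * h\<^sup>2 * c * (w + h)"
    have "S $ 2 $ 2 = n / d * P"
      using pos by (simp add: S, simp add: P_def field_simps power2_eq_square power3_eq_cube)
    also have "P = w' * d + (1 + m * h\<^sup>2) * w * c"
      unfolding P_def using cd by algebra
    finally show ?thesis using pos by (simp add: N_def field_simps)
  qed
  have "trace (matrix_inv I ** S) = 0"
  proof (rule trace_matrix_inv_2; unfold I S11 S12 S22)
    show "E * G - F * F \<noteq> 0"
      unfolding E_def F_def G_def by (rule minimal_equation[OF pos cd ode])
    have "E * N - 2 * F * M + G * L = 0"
      unfolding E_def F_def G_def L_def M_def N_def by (rule minimal_equation[OF pos cd ode])
    then have "n * (E * N - 2 * F * M + G * L) = 0" by simp
    then show "E * (n * N) - F * (n * M) - F * (n * M) + G * (n * L) = 0"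
      by (simp add: algebra_simps)
  qed
  then show ?thesis by (simp add: mean_curvature_def I_def S_def)
qed

end

section \<open>The profile\<close>

locale E_params =
  fixes H \<kappa> m h :: real
  assumes m: "m = - \<kappa> - 4 * H\<^sup>2" "m > 0" "h = 2 * H / m"
begin

definition integrand :: "real \<Rightarrow> real" where
  "integrand t = sqrt ((4 * H\<^sup>2 * (cos t)\<^sup>2 - (4 * H\<^sup>2 + \<kappa>)) / (1 - (sin t)\<^sup>2))"

lemma integrand_eq: "integrand t = sqrt ((4 * H\<^sup>2 * (cos t)\<^sup>2 + m) / (cos t)\<^sup>2)"
  by (simp add: integrand_def m(1) cos_squared_eq)

lemma profile_eq: "profile H \<kappa> \<sigma> s = h * s - \<sigma> / m * integral {0..s} integrand"
proof -
  have "4 * H\<^sup>2 + \<kappa> = - m" using m(1) by simp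
  then show ?thesis
    using m(2) by (simp add: profile_def integrand_def[abs_def] m(3) field_simps)
qed

lemma radicand_pos: "4 * H\<^sup>2 * (cos t)\<^sup>2 + m > 0"
  using m(2) by (simp add: add_nonneg_pos)

lemma integrand_pos: "\<bar>t\<bar> < pi / 2 \<Longrightarrow> integrand t > 0"
  unfolding integrand_eq using radicand_pos[of t] cos_gt_zero_pi[of t]
  by (intro real_sqrt_gt_zero divide_pos_pos zero_less_power) (simp_all add: abs_less_iff)

lemma integrand_squared: "\<bar>t\<bar> < pi / 2 \<Longrightarrow> (integrand t)\<^sup>2 = (4 * H\<^sup>2 * (cos t)\<^sup>2 + m) / (cos t)\<^sup>2"
  using radicand_pos[of t] unfolding integrand_eq by (intro real_sqrt_pow2) simp

text \<open>The square of the integrand is \<open>4 * H^2 + m / cos^2 t\<close>, and half its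
  derivative is \<open>m * sin t / cos^3 t\<close>. Keeping the integrand in the denominator makes
  it cancel in \<open>ode2\<close>; allowing negative \<open>t\<close> gives two-sided continuity at
  0.\<close>

lemma integrand_has_derivative:
  assumes "\<bar>t\<bar> < pi / 2"
  shows "(integrand has_real_derivative m * sin t / (cos t ^ 3 * integrand t)) (at t)"
proof -
  have c: "cos t > 0" using assms by (simp add: cos_gt_zero_pi)
  have "((\<lambda>t. (4 * H\<^sup>2 * (cos t)\<^sup>2 + m) / (cos t)\<^sup>2) has_real_derivative 2 * m * sin t / cos t ^ 3) (at t)"
    using c by (auto intro!: derivative_eq_intros simp: field_simps power2_eq_square power3_eq_cube)
  then have "((\<lambda>t. sqrt ((4 * H\<^sup>2 * (cos t)\<^sup>2 + m) / (cos t)\<^sup>2)) has_real_derivative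
      (inverse (integrand t) / 2) * (2 * m * sin t / cos t ^ 3)) (at t)"
    unfolding integrand_eq using c radicand_pos[of t]
    by (intro DERIV_chain2[where f = sqrt] DERIV_real_sqrt) simp_all
  then show ?thesis
    by (simp add: integrand_eq[abs_def] field_simps)
qed

lemma continuous_on_integrand:
  assumes "S \<subseteq> {- pi / 2<..<pi / 2}"
  shows "continuous_on S integrand"
proof (rule continuous_at_imp_continuous_on, intro ballI)
  fix t assume "t \<in> S"
  then have "t \<in> {- pi / 2<..<pi / 2}" using assms by blast
  then have "\<bar>t\<bar> < pi / 2" by (auto simp: abs_if)
  then show "isCont integrand t" by (rule DERIV_isCont[OF integrand_has_derivative])
qed

lemma profile_has_derivative:
  assumes "0 < s" "s < pi / 2"
  shows "(profile H \<kappa> \<sigma> has_real_derivative h - \<sigma> / m * integrand s) (at s)"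
proof -
  \<comment> \<open>With \<open>b\<close> beyond \<open>s\<close>, the point is interior to a
    compact interval on which the integrand is continuous, so the derivative within that interval is
    a full derivative.\<close>
  obtain b where b: "s < b" "b < pi / 2" using assms dense by blast
  have "((\<lambda>x. integral {0..x} integrand) has_real_derivative integrand s) (at s within {0..b})"
    using assms b by (intro integral_has_real_derivative continuous_on_integrand) auto
  then have "((\<lambda>x. integral {0..x} integrand) has_real_derivative integrand s) (at s)"
    using assms b by (simp add: at_within_Icc_at)
  then show ?thesis
    unfolding profile_eq[abs_def]
    using m(2) by (auto intro!: derivative_eq_intros)
qed

lemma C2_profile:
  "C2_profile (profile H \<kappa> \<sigma>) (\<lambda>s. h - \<sigma> / m * integrand s)
    (\<lambda>s. - \<sigma> / m * (m * sin s / (cos s ^ 3 * integrand s)))"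
proof
  have nz: "cos s \<noteq> 0" "integrand s \<noteq> 0" if "s \<in> {0<..<pi / 2}" for s
    using that integrand_pos[of s] less_imp_neq[OF cos_gt_zero[of s]] by auto
  show "continuous_on {0<..<pi / 2} (\<lambda>s. - \<sigma> / m * (m * sin s / (cos s ^ 3 * integrand s)))"
    using nz m(2) by (intro continuous_intros continuous_on_integrand) auto
  show "(profile H \<kappa> \<sigma> has_real_derivative h - \<sigma> / m * integrand s) (at s)" if "0 < s" "s < pi / 2" for s
    using that by (rule profile_has_derivative)
  show "((\<lambda>s. h - \<sigma> / m * integrand s) has_real_derivative
      - \<sigma> / m * (m * sin s / (cos s ^ 3 * integrand s))) (at s)" if "0 < s" "s < pi / 2" for s
    using that m(2) by (auto intro!: derivative_eq_intros integrand_has_derivative)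
qed

text \<open>Subtracting \<open>h\<close> from the derivative of the profile leaves
  \<open>- \<sigma> / m * integrand s\<close>. Both differential equations are quadratic in this
  quantity and its derivative, so only \<open>\<sigma>^2\<close> enters and either sign is
  covered.\<close>

lemma minimal_surface_profile:
  assumes \<sigma>: "\<sigma>\<^sup>2 = 1"
  shows "minimal_surface E_space (E_metric H \<kappa>) (polar_graph (profile H \<kappa> \<sigma>))"
proof -
  interpret C2_profile "profile H \<kappa> \<sigma>" "\<lambda>s. h - \<sigma> / m * integrand s"
    "\<lambda>s. - \<sigma> / m * (m * sin s / (cos s ^ 3 * integrand s))"
    by (rule C2_profile)
  have "mean_curvature (E_metric H \<kappa>) X N q = 0"
    if "q \<in> polar_domain" "unit_normal (E_metric H \<kappa>) X q N" for q N
  proof (rule mean_curvature_X[OF m _ _ that])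
    fix s :: real assume s: "0 < s" "s < pi / 2"
    have pos: "cos s > 0" "integrand s > 0" using s integrand_pos[of s] cos_gt_zero by auto
    have sq: "(cos s)\<^sup>2 * (integrand s)\<^sup>2 = 4 * H\<^sup>2 * (cos s)\<^sup>2 + m"
      using integrand_squared[of s] s pos by simp
    have "m * (h - \<sigma> / m * integrand s - h)\<^sup>2 * (cos s)\<^sup>2 = \<sigma>\<^sup>2 * ((cos s)\<^sup>2 * (integrand s)\<^sup>2) / m"
      using m(2) by (simp add: power_mult_distrib power_divide power2_eq_square)
    also have "\<dots> = 1 + m * h\<^sup>2 * (cos s)\<^sup>2"
      unfolding sq \<sigma> m(3) using m(2) by (simp add: field_simps power2_eq_square)
    finally show "m * (h - \<sigma> / m * integrand s - h)\<^sup>2 * (cos s)\<^sup>2 = 1 + m * h\<^sup>2 * (cos s)\<^sup>2" .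
    have "m * (h - \<sigma> / m * integrand s - h) * (- \<sigma> / m * (m * sin s / (cos s ^ 3 * integrand s)))
        * cos s ^ 3 = \<sigma>\<^sup>2 * sin s"
      using m(2) pos by (simp add: field_simps power2_eq_square)
    then show "m * (h - \<sigma> / m * integrand s - h) * (- \<sigma> / m * (m * sin s / (cos s ^ 3 * integrand s)))
        * cos s ^ 3 = sin s" by (simp add: \<sigma>)
  qed
  moreover have "polar_graph (profile H \<kappa> \<sigma>) \<subseteq> E_space"
    by (auto simp: polar_graph_def E_space_def intro!: mult_pos_pos sin_gt_zero)
  ultimately show ?thesis
    unfolding minimal_surface_def using local_parametrization_X by blast
qed

section \<open>Boundary values of the profile\<close>

lemma profile_tendsto_0: "(profile H \<kappa> \<sigma> \<longlongrightarrow> 0) (at_right 0)"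
proof -
  \<comment> \<open>Since \<open>pi > 3\<close>, the interval \<open>{0..1}\<close> stays below
    \<open>pi / 2\<close>, where the integrand is continuous.\<close>
  have "continuous_on {0..1} (profile H \<kappa> \<sigma>)"
    unfolding profile_eq[abs_def] using pi_gt3
    by (intro continuous_intros indefinite_integral_continuous_1 integrable_continuous_real
        continuous_on_integrand) auto
  then have "(profile H \<kappa> \<sigma> \<longlongrightarrow> profile H \<kappa> \<sigma> 0) (at 0 within {0..1})"
    by (simp add: continuous_on_def)
  then show ?thesis
    by (simp add: at_within_Icc_at_right profile_eq)
qed

text \<open>The integrand dominates \<open>sqrt m / cos t\<close>, hence \<open>sqrt m * tan t\<close>, whose primitive is elementary.\<close>

lemma integral_integrand_ge:
  assumes "0 < s" "s < pi / 2"
  shows "integral {0..s} integrand \<ge> - sqrt m * ln (cos s)"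
proof -
  have pos: "cos t > 0" if "t \<in> {0..s}" for t
    using that assms by (intro cos_gt_zero_pi) auto
  have "((\<lambda>t. sqrt m * (sin t / cos t)) has_integral - sqrt m * ln (cos s) - - sqrt m * ln (cos 0)) {0..s}"
    using assms pos
    by (intro fundamental_theorem_of_calculus)
      (auto intro!: derivative_eq_intros simp: simp flip: has_real_derivative_iff_has_vector_derivative)
  moreover have "(integrand has_integral integral {0..s} integrand) {0..s}"
    using assms by (intro integrable_integral integrable_continuous_real continuous_on_integrand) auto
  moreover have "sqrt m * (sin t / cos t) \<le> integrand t" if "t \<in> {0..s}" for t
  proof -
    have "sqrt m * (sin t / cos t) \<le> sqrt m * (1 / cos t)"
      using m(2) pos[OF that] by (intro mult_left_mono divide_right_mono) auto
    also have "\<dots> = sqrt (m / (cos t)\<^sup>2)"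
      using pos[OF that] by (simp add: real_sqrt_divide)
    also have "\<dots> \<le> integrand t"
      unfolding integrand_eq by (intro real_sqrt_le_mono divide_right_mono) auto
    finally show ?thesis .
  qed
  ultimately have "- sqrt m * ln (cos s) - - sqrt m * ln (cos 0) \<le> integral {0..s} integrand"
    by (rule has_integral_le)
  then show ?thesis by simp
qed

text \<open>For \<open>\<sigma> = - 1\<close> the integral enters with the positive factor
  \<open>1 / m\<close> and dominates a multiple of \<open>- ln (cos s)\<close>, while the linear
  term stays bounded by \<open>\<bar>h\<bar> * (pi / 2)\<close>.\<close>

lemma profile_at_top: "filterlim (profile H \<kappa> (- 1)) at_top (at_left (pi / 2))"
proof -
  have *: "\<forall>\<^sub>F s in at_left (pi / 2). 0 < s \<and> s < pi / 2"
    using eventually_at_left_real[of 0 "pi / 2"] by simp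
  have "filterlim cos (at_right 0) (at_left (pi / 2))"
    unfolding filterlim_at
  proof
    show "\<forall>\<^sub>F s in at_left (pi / 2). cos s \<in> {0<..} \<and> cos s \<noteq> 0"
      using * by eventually_elim (simp add: cos_gt_zero less_imp_neq[symmetric])
    show "(cos \<longlongrightarrow> 0) (at_left (pi / 2))"
      using isCont_cos[of "pi / 2"] unfolding isCont_def cos_pi_half by (rule filterlim_mono) (simp_all add: at_le)
  qed
  then have "filterlim (\<lambda>s. - ln (cos s)) at_top (at_left (pi / 2))"
    unfolding filterlim_uminus_at_bot[symmetric] by (rule filterlim_compose[OF ln_at_0])
  then have "filterlim (\<lambda>s. - \<bar>h\<bar> * (pi / 2) + sqrt m / m * - ln (cos s)) at_top (at_left (pi / 2))"
    using m(2) by (intro filterlim_tendsto_add_at_top[OF tendsto_const]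
        filterlim_tendsto_pos_mult_at_top[OF tendsto_const]) auto
  then show ?thesis
  proof (rule filterlim_at_top_mono)
    show "\<forall>\<^sub>F s in at_left (pi / 2). - \<bar>h\<bar> * (pi / 2) + sqrt m / m * - ln (cos s) \<le> profile H \<kappa> (- 1) s"
      using *
    proof eventually_elim
      case (elim s)
      have "\<bar>h * s\<bar> \<le> \<bar>h\<bar> * (pi / 2)" using elim unfolding abs_mult by (intro mult_left_mono) auto
      moreover have "sqrt m / m * - ln (cos s) \<le> 1 / m * integral {0..s} integrand"
        using integral_integrand_ge[of s] elim m(2) by (simp add: field_simps)
      ultimately show ?case by (simp add: profile_eq)
    qed
  qed
qed

end

section \<open>Limits of the polar angle at the boundary of the quadrant\<close>

text \<open>This and its counterpart at \<open>pi / 2\<close> carry the one-variable limits of the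
  profile over to the graph function on the quadrant; positivity of both coordinates gives the
  one-sided filter.\<close>

lemma filterlim_polar_angle_at_right:
  assumes "x > 0"
  shows "filterlim (\<lambda>p::real^2. arctan (p $ 2 / p $ 1)) (at_right 0) (at (vector [x, 0]) within quadrant)"
  unfolding filterlim_at
proof
  show "\<forall>\<^sub>F p::real^2 in at (vector [x, 0]) within quadrant. arctan (p $ 2 / p $ 1) \<in> {0<..} \<and> arctan (p $ 2 / p $ 1) \<noteq> 0"
    unfolding eventually_at_filter by (simp add: quadrant_def)
  show "((\<lambda>p::real^2. arctan (p $ 2 / p $ 1)) \<longlongrightarrow> 0) (at (vector [x, 0]) within quadrant)"
    using assms by (auto intro!: tendsto_eq_intros)
qed

lemma filterlim_polar_angle_at_left:
  assumes "y > 0"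
  shows "filterlim (\<lambda>p::real^2. arctan (p $ 2 / p $ 1)) (at_left (pi / 2)) (at (vector [0, y]) within quadrant)"
  unfolding filterlim_at
proof
  let ?F = "at (vector [0, y] :: real^2) within quadrant"
  show "\<forall>\<^sub>F p in ?F. arctan (p $ 2 / p $ 1) \<in> {..<pi / 2} \<and> arctan (p $ 2 / p $ 1) \<noteq> pi / 2"
    using arctan_ubound by (auto simp: less_imp_neq)
  \<comment> \<open>Inside the quadrant the first coordinate tends to 0 from above while the second
    tends to \<open>y > 0\<close>, so the quotient tends to infinity.\<close>
  have "filterlim (\<lambda>p. p $ 1) (at_right 0) ?F"
    unfolding filterlim_at eventually_at_filter
    by (auto simp: quadrant_def intro!: tendsto_eq_intros)
  then have "filterlim (\<lambda>p. inverse (p $ 1)) at_top ?F"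
    by (rule filterlim_compose[OF filterlim_inverse_at_top_right])
  moreover have "((\<lambda>p. p $ 2) \<longlongrightarrow> y) ?F"
    by (auto intro!: tendsto_eq_intros)
  ultimately have "filterlim (\<lambda>p. p $ 2 / p $ 1) at_top ?F"
    unfolding divide_inverse using assms by (intro filterlim_tendsto_pos_mult_at_top)
  then show "((\<lambda>p. arctan (p $ 2 / p $ 1)) \<longlongrightarrow> pi / 2) ?F"
    by (rule filterlim_compose[OF tendsto_arctan_at_top])
qed

section \<open>The vertical geodesic of the base\<close>

text \<open>On a vertical line of the half-plane the geodesic equation is
  \<open>y'' = y'^2 / y\<close>, solved for all times by \<open>exp\<close>; the conformal constant
  \<open>m\<close> cancels.\<close>

lemma base_geodesic:
  fixes H \<kappa> :: real
  assumes "\<kappa> + 4 * H\<^sup>2 < 0"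
  shows "geodesic base_space (base_metric H \<kappa>) (\<lambda>t. exp t *\<^sub>R axis 2 1)"
proof -
  define m where "m = - \<kappa> - 4 * H\<^sup>2"
  have "m > 0" using assms by (simp add: m_def)
  have M: "metric_matrix (base_metric H \<kappa>) p = mat (1 / (m * (p $ 2)\<^sup>2))" for p
    using \<open>m > 0\<close>
    by (simp add: vec_eq_iff forall_2 metric_matrix_def base_metric_def mat_def axis_def conf_factor_def
        power_mult_distrib power_divide flip: m_def)
  have inv: "matrix_inv (mat (1 / (m * y\<^sup>2)) :: real^2^2) = mat (m * y\<^sup>2)" if "y > 0" for y
    using that \<open>m > 0\<close>
    by (intro matrix_inv_eqI) (simp add: vec_eq_iff forall_2 matrix_matrix_mult_def sum_2 mat_def)
  have D: "((\<lambda>y. (mat (1 / (m * y\<^sup>2)) :: real^2^2) $ i $ j) has_real_derivative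
      (if i = j then - 2 / (m * y ^ 3) else 0)) (at y)" if "y > 0" for y i j
    using that \<open>m > 0\<close>
    by (cases "i = j") (auto simp: mat_def intro!: derivative_eq_intros simp: field_simps power2_eq_square power3_eq_cube)
  \<comment> \<open>The velocity is a multiple of the second axis, so the symbols with both lower
    indices 2 determine the equation.\<close>
  have \<Gamma>: "christoffel (base_metric H \<kappa>) p k 2 2 = (if k = 2 then - 1 / p $ 2 else 0)"
    if "p $ 2 > 0" for p and k :: 2
  proof -
    have "\<forall>k. christoffel (base_metric H \<kappa>) p k 2 2 = (if k = 2 then - 1 / p $ 2 else 0)"
      unfolding forall_2 using that \<open>m > 0\<close>
      by (simp add: christoffel_def M partial_deriv_comp_nth[OF D[OF that]] inv sum_2,
          simp add: mat_def field_simps power2_eq_square power3_eq_cube)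
    then show ?thesis by blast
  qed
  show ?thesis
    unfolding geodesic_def
  proof (intro exI allI conjI)
    fix t :: real and k :: 2
    let ?\<gamma> = "\<lambda>t. exp t *\<^sub>R axis 2 1 :: real^2"
    show "?\<gamma> t \<in> base_space" by (simp add: base_space_def axis_def)
    \<comment> \<open>The exponential curve is its own first and second derivative, which fixes both
      existential witnesses.\<close>
    show "(?\<gamma> has_vector_derivative ?\<gamma> t) (at t)" "(?\<gamma> has_vector_derivative ?\<gamma> t) (at t)"
      by (auto intro!: derivative_eq_intros simp: has_vector_derivative_def)
    show "?\<gamma> t $ k + (\<Sum>i\<in>UNIV. \<Sum>j\<in>UNIV. christoffel (base_metric H \<kappa>) (?\<gamma> t) k i j * ?\<gamma> t $ i * ?\<gamma> t $ j) = 0"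
      by (simp add: sum_2 axis_def \<Gamma>)
  qed
qed

lemma range_base_geodesic: "range (\<lambda>t. exp t *\<^sub>R axis 2 1 :: real^2) = {p. p $ 1 = 0 \<and> p $ 2 > 0}"
proof (intro equalityI subsetI)
  fix p :: "real^2" assume "p \<in> {p. p $ 1 = 0 \<and> p $ 2 > 0}"
  then show "p \<in> range (\<lambda>t. exp t *\<^sub>R axis 2 1)"
    by (intro image_eqI[of _ _ "ln (p $ 2)"]) (simp_all add: vec_eq_iff forall_2 axis_def)
qed (auto simp: axis_def)

theorem mainTheorem3:
  fixes H \<kappa> :: real
  assumes "\<kappa> + 4 * H\<^sup>2 < 0"
  shows "(\<forall>\<sigma>\<in>{1, -1}. minimal_surface E_space (E_metric H \<kappa>) (polar_graph (profile H \<kappa> \<sigma>)))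
    \<and> (\<exists>\<sigma>\<in>{1, -1}.
         (profile H \<kappa> \<sigma> \<longlongrightarrow> 0) (at_right 0)
       \<and> (\<forall>x>0. (graph_fun (profile H \<kappa> \<sigma>) \<longlongrightarrow> 0) (at (vector [x, 0]) within quadrant))
       \<and> filterlim (profile H \<kappa> \<sigma>) at_top (at_left (pi / 2))
       \<and> (\<forall>y>0. filterlim (graph_fun (profile H \<kappa> \<sigma>)) at_top (at (vector [0, y]) within quadrant)))
    \<and> (\<exists>\<gamma>. geodesic base_space (base_metric H \<kappa>) \<gamma>
           \<and> range \<gamma> = {p. p $ 1 = 0 \<and> p $ 2 > 0})"
proof -
  define m where "m = - \<kappa> - 4 * H\<^sup>2"
  interpret E_params H \<kappa> m "2 * H / m"
    using assms by unfold_locales (simp_all add: m_def)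
  show ?thesis
  proof (intro conjI ballI)
    show "minimal_surface E_space (E_metric H \<kappa>) (polar_graph (profile H \<kappa> \<sigma>))" if "\<sigma> \<in> {1, -1}" for \<sigma>
      using that by (intro minimal_surface_profile) auto
    have graph: "graph_fun (profile H \<kappa> (- 1)) = (\<lambda>p. profile H \<kappa> (- 1) (arctan (p $ 2 / p $ 1)))"
      by (simp add: fun_eq_iff graph_fun_def)
    \<comment> \<open>The suitable sign is \<open>- 1\<close>: the limit 0 holds for either sign,
      and this one makes the integral push the profile upwards.\<close>
    show "\<exists>\<sigma>\<in>{1, -1}.
         (profile H \<kappa> \<sigma> \<longlongrightarrow> 0) (at_right 0)
       \<and> (\<forall>x>0. (graph_fun (profile H \<kappa> \<sigma>) \<longlongrightarrow> 0) (at (vector [x, 0]) within quadrant))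
       \<and> filterlim (profile H \<kappa> \<sigma>) at_top (at_left (pi / 2))
       \<and> (\<forall>y>0. filterlim (graph_fun (profile H \<kappa> \<sigma>)) at_top (at (vector [0, y]) within quadrant))"
      using profile_tendsto_0[of "- 1"] profile_at_top
      by (intro bexI[of _ "- 1"] conjI allI impI)
        (auto simp: graph intro: filterlim_compose[OF _ filterlim_polar_angle_at_right]
          filterlim_compose[OF _ filterlim_polar_angle_at_left])
    show "\<exists>\<gamma>. geodesic base_space (base_metric H \<kappa>) \<gamma> \<and> range \<gamma> = {p. p $ 1 = 0 \<and> p $ 2 > 0}"
      using base_geodesic[OF assms] range_base_geodesic by blast
  qed
qed

end
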